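(* Let $(X,f_{1,\infty})$ and $(Y,g_{1,\infty})$ be NDS with $f_{1,\infty}$ and $g_{1,\infty}$ feeble open. Let $f:X\to X$ and $g:Y\to Y$ be continuous maps and suppose that $\{f_n^{k}\}_{k\in\mathbb{N}}$ converges collectively to $\{f^k\}_{k\in\mathbb{N}}$ and that $\{g_n^{k}\}_{k\in\mathbb{N}}$ converges collectively to $\{g^k\}_{k\in\mathbb{N}}$. If $f_{1,\infty}$ and $g_{1,\infty}$ are both syndetically transitive and weakly mixing, then $f_{1,\infty}\times g_{1,\infty}$ is syndetically transitive and weakly mixing.
   Context: $\mathbb{N}=\{1,2,3,\dots\}$. A non-autonomous discrete dynamical system (NDS) $(X,f_{1,\infty})$ consists of a compact metric space $(X,d)$ and a sequence $f_{1,\infty}=\{f_n\}_{n=1}^\infty$ of continuous maps $f_n:X\to X$. For $i,n\in\mathbb{N}$, $f_i^n:=f_{i+(n-1)}\circ\cdots\circ f_i$, and $f_i^0=\mathrm{id}_X$. The product NDS $f_{1,\infty}\times g_{1,\infty}$ on $X\times Y$ has $n$-th map $f_n\times g_n$. $f_{1,\infty}$ is feeble open if $\mathrm{int}(f_i(U))\neq\emptyset$ for every nonempty open $U\subseteq X$ and every $i\in\mathbb{N}$. Collective convergence: with $D(f,g)=\sup_{x\in X}d(f(x),g(x))$, $\{f_n^{k}\}_{k\in\mathbb{N}}$ converges collectively to $\{f^k\}_{k\in\mathbb{N}}$ if for every $\varepsilon>0$ there is $r_0\in\mathbb{N}$ such that $D(f_r^k,f^k)<\varepsilon$ for all $r\ge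 r_0$ and all $k\in\mathbb{N}$ (where $f^k$ is the $k$-fold composition of $f$). Definitions (for any NDS). Weakly mixing: for any nonempty open $U_1,U_2,V_1,V_2\subseteq X$ there is $n\in\mathbb{N}$ with $f_1^n(U_1)\cap V_1\neq\emptyset$ and $f_1^n(U_2)\cap V_2\neq\emptyset$. A set $A\subseteq\mathbb{N}$ is syndetic if there is $M\in\mathbb{N}$ with $\{i,i+1,\dots,i+M\}\cap A\neq\emptyset$ for every $i\in\mathbb{N}$. Syndetically transitive: for any nonempty open $U,V\subseteq X$ the set $\{n\in\mathbb{N}: f_1^n(U)\cap V\neq\emptyset\}$ is syndetic. *)

theory Defs
  imports "HOL-Analysis.Analysis"
begin

text \<open>
  A space is a metric type whose universe is compact. A sequence of maps indexed by
  {1, 2, 3, ...} is a function on \<open>nat\<close> whose value at index 0 is never used: every quantifier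
  over indices and times below is restricted to positive numbers.
\<close>

definition nds :: "(nat \<Rightarrow> 'a::metric_space \<Rightarrow> 'a) \<Rightarrow> bool" where
  "nds f \<longleftrightarrow> compact (UNIV :: 'a set) \<and> (\<forall>n\<ge>1. continuous_on UNIV (f n))"

text \<open>\<open>orbit_map f i n\<close> is the composition of the n maps \<open>f i\<close>, ..., \<open>f (i + n - 1)\<close>, with \<open>f i\<close>
  applied first.\<close>

primrec orbit_map :: "(nat \<Rightarrow> 'a \<Rightarrow> 'a) \<Rightarrow> nat \<Rightarrow> nat \<Rightarrow> 'a \<Rightarrow> 'a" where
  "orbit_map f i 0 = id"
| "orbit_map f i (Suc n) = f (i + n) \<circ> orbit_map f i n"

definition prod_nds ::
  "(nat \<Rightarrow> 'a \<Rightarrow> 'a) \<Rightarrow> (nat \<Rightarrow> 'b \<Rightarrow> 'b) \<Rightarrow> nat \<Rightarrow> 'a \<times> 'b \<Rightarrow> 'a \<times> 'b" where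
  "prod_nds f g = (\<lambda>n. map_prod (f n) (g n))"

definition feeble_open :: "(nat \<Rightarrow> 'a::topological_space \<Rightarrow> 'a) \<Rightarrow> bool" where
  "feeble_open f \<longleftrightarrow> (\<forall>i\<ge>1. \<forall>U. open U \<and> U \<noteq> {} \<longrightarrow> interior (f i ` U) \<noteq> {})"

text \<open>The supremum is over a bounded set of reals whenever the space is compact.\<close>

definition sup_dist :: "('a::metric_space \<Rightarrow> 'a) \<Rightarrow> ('a \<Rightarrow> 'a) \<Rightarrow> real" where
  "sup_dist f g = (SUP x. dist (f x) (g x))"

definition converges_collectively ::
  "(nat \<Rightarrow> 'a::metric_space \<Rightarrow> 'a) \<Rightarrow> ('a \<Rightarrow> 'a) \<Rightarrow> bool" where
  "converges_collectively fs f \<longleftrightarrow>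
     (\<forall>\<epsilon>>0. \<exists>r0\<ge>1. \<forall>r\<ge>r0. \<forall>k\<ge>1. sup_dist (orbit_map fs r k) (f ^^ k) < \<epsilon>)"

definition weakly_mixing :: "(nat \<Rightarrow> 'a::topological_space \<Rightarrow> 'a) \<Rightarrow> bool" where
  "weakly_mixing f \<longleftrightarrow>
     (\<forall>U1 U2 V1 V2. open U1 \<and> U1 \<noteq> {} \<and> open U2 \<and> U2 \<noteq> {} \<and>
                    open V1 \<and> V1 \<noteq> {} \<and> open V2 \<and> V2 \<noteq> {} \<longrightarrow>
        (\<exists>n\<ge>1. orbit_map f 1 n ` U1 \<inter> V1 \<noteq> {} \<and> orbit_map f 1 n ` U2 \<inter> V2 \<noteq> {}))"

definition syndetic :: "nat set \<Rightarrow> bool" where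
  "syndetic A \<longleftrightarrow> (\<exists>M\<ge>1. \<forall>i\<ge>1. {i..i + M} \<inter> A \<noteq> {})"

definition syndetically_transitive :: "(nat \<Rightarrow> 'a::topological_space \<Rightarrow> 'a) \<Rightarrow> bool" where
  "syndetically_transitive f \<longleftrightarrow>
     (\<forall>U V. open U \<and> U \<noteq> {} \<and> open V \<and> V \<noteq> {} \<longrightarrow>
        syndetic {n. n \<ge> 1 \<and> orbit_map f 1 n ` U \<inter> V \<noteq> {}})"

lemma nds_prod_nds:
  fixes f :: "nat \<Rightarrow> 'a::metric_space \<Rightarrow> 'a" and g :: "nat \<Rightarrow> 'b::metric_space \<Rightarrow> 'b"
  assumes "nds f" "nds g"
  shows "nds (prod_nds f g)"
proof -
  have "compact ((UNIV :: 'a set) \<times> (UNIV :: 'b set))"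
    using assms unfolding nds_def by (blast intro: compact_Times)
  moreover have "continuous_on UNIV (map_prod (f n) (g n))" if "n \<ge> 1" for n
  proof -
    have f: "continuous_on UNIV (f n)" and g: "continuous_on UNIV (g n)"
      using assms that unfolding nds_def by blast+
    have "continuous_on UNIV (\<lambda>p::'a \<times> 'b. f n (fst p))"
      by (rule continuous_on_compose2[OF f continuous_on_fst[OF continuous_on_id]]) simp
    moreover have "continuous_on UNIV (\<lambda>p::'a \<times> 'b. g n (snd p))"
      by (rule continuous_on_compose2[OF g continuous_on_snd[OF continuous_on_id]]) simp
    ultimately have "continuous_on UNIV (\<lambda>p. (f n (fst p), g n (snd p)))"
      by (rule continuous_on_Pair)
    moreover have "map_prod (f n) (g n) = (\<lambda>p. (f n (fst p), g n (snd p)))"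
      by (rule ext) (simp add: map_prod_def split_beta)
    ultimately show ?thesis by simp
  qed
  ultimately show ?thesis by (simp add: nds_def prod_nds_def)
qed

end

theory Submission
  imports Defs
begin

text \<open>
  Collective convergence lets the tails of \<open>fs\<close> shadow the iterates of \<open>f\<close> uniformly in time,
  so weak mixing and syndetic transitivity pass from \<open>fs\<close> to \<open>f\<close>. For the single map \<open>f\<close>,
  Furstenberg's intersection lemma puts a hitting time set inside any finite intersection of
  hitting time sets; applied to the sets for \<open>U\<close> and the preimages of \<open>V\<close> under the iterates
  of \<open>f\<close>, it shows that the hitting times of \<open>f\<close> are thickly syndetic. Feeble openness carries
  this back to \<open>fs\<close>. Thickly syndetic sets are closed under finite intersections, so the hitting
  times of the two systems can be intersected.
\<close>

section \<open>Hitting times, syndetic and thickly syndetic sets\<close>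

text \<open>The argument \<open>F\<close> is any family of maps indexed by time, so that one notion
  serves both \<open>orbit_map fs 1\<close> and the iterates
  \<open>\<lambda>k. f ^^ k\<close>.\<close>

definition hits :: "(nat \<Rightarrow> 'a \<Rightarrow> 'a) \<Rightarrow> 'a set \<Rightarrow> 'a set \<Rightarrow> nat set" where
  "hits F U V = {n. n \<ge> 1 \<and> F n ` U \<inter> V \<noteq> {}}"

lemma hits_iff: "n \<in> hits F U V \<longleftrightarrow> n \<ge> 1 \<and> (\<exists>x\<in>U. F n x \<in> V)"
  by (auto simp: hits_def)

lemma hits_mono: "U \<subseteq> U' \<Longrightarrow> V \<subseteq> V' \<Longrightarrow> hits F U V \<subseteq> hits F U' V'"
  by (fastforce simp: hits_iff)

text \<open>The starts of blocks of \<open>L + 1\<close> consecutive members must recur with bounded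
  gaps. A start at 0 has no influence, since \<open>syndetic\<close> tests only windows that begin
  at 1 or later.\<close>

definition thickly_syndetic :: "nat set \<Rightarrow> bool" where
  "thickly_syndetic A \<longleftrightarrow> (\<forall>L. syndetic {n. {n..n + L} \<subseteq> A})"

lemma syndetic_mono: "syndetic A \<Longrightarrow> A \<subseteq> B \<Longrightarrow> syndetic B"
  unfolding syndetic_def by blast

lemma syndeticI:
  assumes "\<And>i. i \<ge> 1 \<Longrightarrow> \<exists>n\<in>A. i \<le> n \<and> n \<le> i + M"
  shows "syndetic A"
  unfolding syndetic_def
\<comment> \<open>The definition demands a positive bound, whereas \<open>M\<close> may be
  0.\<close>
proof (intro exI[of _ "max 1 M"] conjI allI impI)
  fix i :: nat assume "i \<ge> 1"
  then obtain n where "n \<in> A" "i \<le> n" "n \<le> i + M" using assms by blast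
  then have "n \<in> {i..i + max 1 M} \<inter> A" by auto
  then show "{i..i + max 1 M} \<inter> A \<noteq> {}" by blast
qed simp

lemma syndeticE:
  assumes "syndetic A"
  obtains M where "\<And>i. i \<ge> 1 \<Longrightarrow> \<exists>n\<in>A. i \<le> n \<and> n \<le> i + M"
proof -
  from assms obtain M where M: "\<forall>i\<ge>1. {i..i + M} \<inter> A \<noteq> {}"
    unfolding syndetic_def by blast
  have "\<exists>n\<in>A. i \<le> n \<and> n \<le> i + M" if "i \<ge> 1" for i
    using M that by fastforce
  then show thesis by (rule that)
qed

lemma thickly_syndetic_mono: "thickly_syndetic A \<Longrightarrow> A \<subseteq> B \<Longrightarrow> thickly_syndetic B"
  unfolding thickly_syndetic_def by (blast intro: syndetic_mono)

lemma thickly_syndetic_imp_syndetic: "thickly_syndetic A \<Longrightarrow> syndetic A"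
  unfolding thickly_syndetic_def by (erule allE[of _ 0]) simp

text \<open>Blocks of length \<open>L\<close> in \<open>A\<close> start with gaps at most
  \<open>M\<close>, so a block of length \<open>L + M\<close> in \<open>B\<close> contains a whole
  one of them. Such long blocks of \<open>B\<close> start with gaps at most \<open>K\<close>, which
  gives the bound \<open>M + K\<close>.\<close>

lemma thickly_syndetic_Int:
  assumes "thickly_syndetic A" "thickly_syndetic B"
  shows "thickly_syndetic (A \<inter> B)"
  unfolding thickly_syndetic_def
proof
  fix L
  obtain M where M: "\<And>i. i \<ge> 1 \<Longrightarrow> \<exists>n\<in>{n. {n..n + L} \<subseteq> A}. i \<le> n \<and> n \<le> i + M"
    using assms(1) unfolding thickly_syndetic_def by (meson syndeticE)
  obtain K where K: "\<And>i. i \<ge> 1 \<Longrightarrow> \<exists>n\<in>{n. {n..n + (L + M)} \<subseteq> B}. i \<le> n \<and> n \<le> i + K"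
    using assms(2) unfolding thickly_syndetic_def by (meson syndeticE)
  show "syndetic {n. {n..n + L} \<subseteq> A \<inter> B}"
  proof (rule syndeticI[where M = "M + K"])
    fix i :: nat assume i: "i \<ge> 1"
    obtain n where n: "{n..n + (L + M)} \<subseteq> B" "i \<le> n" "n \<le> i + K" using K[OF i] by blast
    obtain m where m: "{m..m + L} \<subseteq> A" "n \<le> m" "m \<le> n + M" using M[of n] i n(2) by auto
    have "{m..m + L} \<subseteq> {n..n + (L + M)}" using m by auto
    then have "m \<in> {n. {n..n + L} \<subseteq> A \<inter> B}" using n(1) m(1) by blast
    moreover have "i \<le> m" "m \<le> i + (M + K)" using n m by auto
    ultimately show "\<exists>n\<in>{n. {n..n + L} \<subseteq> A \<inter> B}. i \<le> n \<and> n \<le> i + (M + K)" by blast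
  qed
qed

lemma syndetic_shift_down:
  assumes "syndetic A"
  shows "syndetic {k. k \<ge> 1 \<and> n + k \<in> A}"
proof -
  obtain M where M: "\<And>i. i \<ge> 1 \<Longrightarrow> \<exists>m\<in>A. i \<le> m \<and> m \<le> i + M" using assms by (meson syndeticE)
  show ?thesis
  proof (rule syndeticI[where M = M])
    fix i :: nat assume i: "i \<ge> 1"
    then obtain m where m: "m \<in> A" "n + i \<le> m" "m \<le> n + i + M" using M[of "n + i"] by auto
    then have "m - n \<in> {k. k \<ge> 1 \<and> n + k \<in> A}" using i by auto
    moreover have "i \<le> m - n" "m - n \<le> i + M" using m by auto
    ultimately show "\<exists>k\<in>{k. k \<ge> 1 \<and> n + k \<in> A}. i \<le> k \<and> k \<le> i + M" by blast
  qed
qed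

lemma syndetic_shift_up:
  assumes "syndetic A"
  shows "syndetic ((+) n ` A)"
proof -
  obtain M where M: "\<And>i. i \<ge> 1 \<Longrightarrow> \<exists>m\<in>A. i \<le> m \<and> m \<le> i + M" using assms by (meson syndeticE)
  show ?thesis
  proof (rule syndeticI[where M = "M + n"])
    fix i :: nat assume "i \<ge> 1"
    then obtain m where m: "m \<in> A" "i \<le> m" "m \<le> i + M" using M by blast
    then have "n + m \<in> (+) n ` A" "i \<le> n + m" "n + m \<le> i + (M + n)" by auto
    then show "\<exists>k\<in>(+) n ` A. i \<le> k \<and> k \<le> i + (M + n)" by blast
  qed
qed

lemma thickly_syndetic_shift_up:
  assumes "thickly_syndetic A"
  shows "thickly_syndetic ((+) n ` A)"
  unfolding thickly_syndetic_def
proof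
  fix L
  have "syndetic ((+) n ` {m. {m..m + L} \<subseteq> A})"
    using assms unfolding thickly_syndetic_def by (blast intro: syndetic_shift_up)
  moreover have "(+) n ` {m. {m..m + L} \<subseteq> A} \<subseteq> {m. {m..m + L} \<subseteq> (+) n ` A}"
  proof clarify
    fix m k assume *: "{m..m + L} \<subseteq> A" and k: "k \<in> {n + m..n + m + L}"
    then have "k - n \<in> {m..m + L}" "k = n + (k - n)" by auto
    with * have "k - n \<in> A" "k = n + (k - n)" by blast+
    then show "k \<in> (+) n ` A" by blast
  qed
  ultimately show "syndetic {m. {m..m + L} \<subseteq> (+) n ` A}" by (rule syndetic_mono)
qed

section \<open>Orbit maps: composition, continuity, feeble openness\<close>

lemma orbit_map_add: "orbit_map f i (n + k) x = orbit_map f (i + n) k (orbit_map f i n x)"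
  by (induction k) (auto simp: add.assoc)

lemma orbit_map_const: "orbit_map (\<lambda>_. f) i = (\<lambda>n. f ^^ n)"
proof
  show "orbit_map (\<lambda>_. f) i n = f ^^ n" for n by (induction n) auto
qed

lemma orbit_map_prod_nds:
  "orbit_map (prod_nds f g) i n (x, y) = (orbit_map f i n x, orbit_map g i n y)"
  by (induction n) (auto simp: prod_nds_def)

lemma continuous_orbit_map:
  assumes "nds fs" "i \<ge> 1"
  shows "continuous_on UNIV (orbit_map fs i n)"
proof (induction n)
  case 0
  show ?case by (simp add: id_def)
next
  case (Suc n)
  have "continuous_on UNIV (fs (i + n))" using assms unfolding nds_def by simp
  then show ?case using Suc
    by (auto simp del: o_apply simp: continuous_on_compose continuous_on_subset)
qed

lemma open_vimage_orbit_map: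
  assumes "nds fs" "i \<ge> 1" "open V"
  shows "open (orbit_map fs i n -` V)"
  using continuous_orbit_map[OF assms(1,2)] assms(3) by (simp add: continuous_on_open_vimage)

text \<open>Images of open sets need not be open, so the induction replaces each image by its
  interior before the next map is applied.\<close>

lemma feeble_open_orbit_map:
  assumes "feeble_open fs" "i \<ge> 1" "open U" "U \<noteq> {}"
  shows "interior (orbit_map fs i n ` U) \<noteq> {}"
proof (induction n)
  case 0
  then show ?case using assms by (simp add: interior_open)
next
  case (Suc n)
  have "interior (fs (i + n) ` interior (orbit_map fs i n ` U)) \<noteq> {}"
    using assms(1,2) Suc unfolding feeble_open_def by simp
  moreover have "fs (i + n) ` interior (orbit_map fs i n ` U) \<subseteq> orbit_map fs i (Suc n) ` U"
    using interior_subset[of "orbit_map fs i n ` U"] by fastforce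
  ultimately show ?case using interior_mono by blast
qed

section \<open>Uniform shadowing by the limit map\<close>

text \<open>Compactness bounds the distances, so the supremum in \<open>sup_dist\<close> is a
  genuine upper bound.\<close>

lemma dist_le_sup_dist:
  fixes f g :: "'a::metric_space \<Rightarrow> 'a"
  assumes "compact (UNIV :: 'a set)"
  shows "dist (f x) (g x) \<le> sup_dist f g"
  unfolding sup_dist_def
proof (rule cSUP_upper)
  obtain e where "\<forall>x\<in>UNIV. \<forall>y\<in>UNIV. dist (x::'a) y \<le> e"
    using compact_imp_bounded[OF assms] unfolding bounded_two_points by blast
  then show "bdd_above (range (\<lambda>x. dist (f x) (g x)))" by (intro bdd_aboveI[of _ e]) auto
qed simp

text \<open>The set \<open>V'\<close> is a ball of half the radius of a ball inside
  \<open>V\<close>; the other half absorbs the distance between the two orbits. Neither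
  \<open>V'\<close> nor the threshold \<open>r\<close> depends on the time \<open>k\<close>, which
  is where collective convergence enters.\<close>

lemma shadowing:
  fixes fs :: "nat \<Rightarrow> 'a::metric_space \<Rightarrow> 'a"
  assumes "nds fs" "converges_collectively fs f" "open V" "V \<noteq> {}"
  obtains V' r where "open V'" "V' \<noteq> {}"
    "\<And>n k x. r \<le> n \<Longrightarrow> k \<ge> 1 \<Longrightarrow> orbit_map fs (1 + n) k x \<in> V' \<Longrightarrow> (f ^^ k) x \<in> V"
    "\<And>n k x. r \<le> n \<Longrightarrow> k \<ge> 1 \<Longrightarrow> (f ^^ k) x \<in> V' \<Longrightarrow> orbit_map fs (1 + n) k x \<in> V"
proof -
  obtain v e where v: "e > 0" "ball v e \<subseteq> V" using assms(3,4) by (meson equals0I open_contains_ball)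
  then obtain r where r: "\<forall>n\<ge>r. \<forall>k\<ge>1. sup_dist (orbit_map fs n k) (f ^^ k) < e / 2"
    using assms(2) unfolding converges_collectively_def by (meson half_gt_zero)
  have close: "dist (orbit_map fs (1 + n) k x) ((f ^^ k) x) < e / 2" if "r \<le> n" "k \<ge> 1" for n k :: nat and x
  proof -
    have "sup_dist (orbit_map fs (1 + n) k) (f ^^ k) < e / 2" using r that by simp
    moreover have "compact (UNIV :: 'a set)" using assms(1) by (simp add: nds_def)
    ultimately show ?thesis using dist_le_sup_dist le_less_trans by blast
  qed
  show thesis
  proof (rule that[of "ball v (e / 2)" r])
    fix n k :: nat and x assume nk: "r \<le> n" "k \<ge> 1"
    show "(f ^^ k) x \<in> V" if "orbit_map fs (1 + n) k x \<in> ball v (e / 2)"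
    proof -
      have "dist v ((f ^^ k) x) < e"
        using that close[OF nk, of x] dist_triangle[of v "(f ^^ k) x" "orbit_map fs (1 + n) k x"]
        unfolding mem_ball by linarith
      then show ?thesis using v(2) by auto
    qed
    show "orbit_map fs (1 + n) k x \<in> V" if "(f ^^ k) x \<in> ball v (e / 2)"
    proof -
      have "dist v (orbit_map fs (1 + n) k x) < e"
        using that close[OF nk, of x] dist_triangle2[of v "orbit_map fs (1 + n) k x" "(f ^^ k) x"]
        unfolding mem_ball by linarith
      then show ?thesis using v(2) by auto
    qed
  qed (use v in auto)
qed

section \<open>Arbitrarily late hitting times from weak mixing\<close>

lemma weakly_mixingD:
  assumes "weakly_mixing fs" "open U1" "U1 \<noteq> {}" "open U2" "U2 \<noteq> {}"
    "open V1" "V1 \<noteq> {}" "open V2" "V2 \<noteq> {}"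
  shows "\<exists>n. n \<in> hits (orbit_map fs 1) U1 V1 \<and> n \<in> hits (orbit_map fs 1) U2 V2"
proof -
  have "\<exists>n\<ge>1. orbit_map fs 1 n ` U1 \<inter> V1 \<noteq> {} \<and> orbit_map fs 1 n ` U2 \<inter> V2 \<noteq> {}"
    using assms unfolding weakly_mixing_def by auto
  then show ?thesis unfolding hits_def by blast
qed

text \<open>With \<open>{p}\<close> as both source sets, the single image of \<open>p\<close> at one
  time would have to lie in two disjoint targets.\<close>

lemma weakly_mixing_isolated_point:
  fixes fs :: "nat \<Rightarrow> 'a::t2_space \<Rightarrow> 'a" and p q :: 'a
  assumes "weakly_mixing fs" "open {p}"
  shows "q = p"
proof (rule ccontr)
  assume "q \<noteq> p"
  then obtain V W where VW: "open V" "open W" "q \<in> V" "p \<in> W" "V \<inter> W = {}"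
    using hausdorff[of q p] by auto
  have "V \<noteq> {}" "W \<noteq> {}" using VW by auto
  then obtain n where "n \<in> hits (orbit_map fs 1) {p} V" "n \<in> hits (orbit_map fs 1) {p} W"
    using weakly_mixingD[OF assms(1,2) _ assms(2) _ VW(1) _ VW(2)] by auto
  then show False using VW(5) by (auto simp: hits_iff)
qed

text \<open>In a space without isolated points, \<open>U1\<close> and \<open>V1\<close> can be shrunk so as to have no hitting
  time below \<open>N\<close>; a space with an isolated point is a singleton.\<close>

lemma weakly_mixing_unbounded:
  fixes fs :: "nat \<Rightarrow> 'a::metric_space \<Rightarrow> 'a"
  assumes "nds fs" "weakly_mixing fs" "open U1" "U1 \<noteq> {}" "open U2" "U2 \<noteq> {}"
    "open V1" "V1 \<noteq> {}" "open V2" "V2 \<noteq> {}"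
  shows "\<exists>n>N. n \<in> hits (orbit_map fs 1) U1 V1 \<and> n \<in> hits (orbit_map fs 1) U2 V2"
proof (cases "\<exists>p::'a. open {p}")
  case True
  then obtain p where "open {p::'a}" by blast
  then have all: "W = UNIV" if "W \<noteq> {}" for W :: "'a set"
    using weakly_mixing_isolated_point[OF assms(2)] that by (metis UNIV_eq_I ex_in_conv)
  have "U1 = UNIV" "V1 = UNIV" "U2 = UNIV" "V2 = UNIV" using all assms by blast+
  then show ?thesis by (intro exI[of _ "Suc N"]) (simp add: hits_iff)
next
  case False
  obtain x where x: "x \<in> U1" using assms by blast
  \<comment> \<open>The set \<open>S\<close> is the orbit of \<open>x\<close> up to time
    \<open>N\<close>. A finite nonempty open set would yield an isolated point, so \<open>V1\<close>
    contains some \<open>v\<close> outside \<open>S\<close>.\<close>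
  define S where "S = (\<lambda>j. orbit_map fs 1 j x) ` {..N}"
  have "finite S" by (simp add: S_def)
  have "\<not> V1 \<subseteq> S"
  proof
    assume "V1 \<subseteq> S"
    then have fin: "finite V1" using \<open>finite S\<close> finite_subset by blast
    obtain p where p: "p \<in> V1" using assms by blast
    have "open (V1 - (V1 - {p}))" using fin assms by (intro open_Diff finite_imp_closed) auto
    moreover have "V1 - (V1 - {p}) = {p}" using p by blast
    ultimately show False using False by metis
  qed
  then obtain v where v: "v \<in> V1" "v \<notin> S" by blast
  obtain d where "d > 0" "ball v d \<subseteq> - S"
    using finite_imp_closed[OF \<open>finite S\<close>] v(2)
    by (metis ComplI open_Compl open_contains_ball)
  then have d: "d > 0" "\<forall>y\<in>S. d \<le> dist v y" by (auto simp: subset_iff not_less[symmetric])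
  define V where "V = V1 \<inter> ball v (d / 2)"
  \<comment> \<open>Points of \<open>U\<close> stay more than \<open>d / 2\<close> away from
    \<open>v\<close> up to time \<open>N\<close>, hence miss \<open>V\<close>. The point
    \<open>x\<close> qualifies because its orbit keeps distance at least \<open>d\<close> from
    \<open>v\<close> until then.\<close>
  define U where "U = U1 \<inter> (\<Inter>j\<in>{..N}. orbit_map fs 1 j -` (- cball v (d / 2)))"
  have "open U" unfolding U_def
    by (intro open_Int assms open_INT ballI open_vimage_orbit_map open_Compl closed_cball) auto
  moreover have "x \<in> U" using x d by (force simp: U_def S_def)
  moreover have "open V" "v \<in> V" using v d assms by (auto simp: V_def)
  ultimately obtain n where n: "n \<in> hits (orbit_map fs 1) U V" "n \<in> hits (orbit_map fs 1) U2 V2"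
    using weakly_mixingD[OF assms(2), of U U2 V V2] assms by blast
  have "n > N"
  proof (rule ccontr)
    assume "\<not> n > N"
    then have "orbit_map fs 1 n y \<notin> cball v (d / 2)" if "y \<in> U" for y
      using that by (auto simp: U_def)
    then show False using n(1) by (fastforce simp: hits_iff V_def)
  qed
  moreover have "hits (orbit_map fs 1) U V \<subseteq> hits (orbit_map fs 1) U1 V1"
    by (rule hits_mono) (auto simp: U_def V_def)
  ultimately show ?thesis using n by blast
qed

section \<open>Transfer from the sequence to the limit map\<close>

text \<open>A point in the preimage of \<open>U\<close> under the first \<open>n\<close> maps is in
  \<open>U\<close> at time \<open>n\<close>; its position there is the witness for \<open>f\<close>,
  whose iterates imitate the remaining \<open>k\<close> steps.\<close>

lemma hits_limit:
  fixes fs :: "nat \<Rightarrow> 'a::metric_space \<Rightarrow> 'a"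
  assumes "nds fs" "\<And>x. orbit_map fs (1 + n) k x \<in> V' \<Longrightarrow> (f ^^ k) x \<in> V"
    and "n + k \<in> hits (orbit_map fs 1) (orbit_map fs 1 n -` U) V'" "k \<ge> 1"
  shows "k \<in> hits (\<lambda>k. f ^^ k) U V"
  using assms(2-4) unfolding hits_iff orbit_map_add by blast

lemma limit_syndetically_transitive:
  fixes fs :: "nat \<Rightarrow> 'a::metric_space \<Rightarrow> 'a"
  assumes "nds fs" "converges_collectively fs f" "syndetically_transitive fs" "weakly_mixing fs"
  shows "syndetically_transitive (\<lambda>_. f)"
  unfolding syndetically_transitive_def hits_def[symmetric] orbit_map_const
proof (intro allI impI, elim conjE)
  fix U V :: "'a set"
  assume UV: "open U" "U \<noteq> {}" "open V" "V \<noteq> {}"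
  obtain V' r where V': "open V'" "V' \<noteq> {}"
    and sh: "\<And>n k x. r \<le> n \<Longrightarrow> k \<ge> 1 \<Longrightarrow> orbit_map fs (1 + n) k x \<in> V' \<Longrightarrow> (f ^^ k) x \<in> V"
    using shadowing[OF assms(1,2) UV(3,4)] by metis
  \<comment> \<open>A time \<open>n\<close> past the shadowing threshold is wanted at which the
    preimage of \<open>U\<close> is nonempty; late hitting times of \<open>U\<close> from the whole
    space provide it.\<close>
  obtain n where n: "n > r" "n \<in> hits (orbit_map fs 1) UNIV U"
    using weakly_mixing_unbounded[OF assms(1,4), of UNIV UNIV U U r] UV by auto
  let ?U = "orbit_map fs 1 n -` U"
  have "open ?U" "?U \<noteq> {}" using open_vimage_orbit_map[OF assms(1)] UV n by (auto simp: hits_iff)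
  then have "syndetic (hits (orbit_map fs 1) ?U V')"
    using assms(3) V' unfolding syndetically_transitive_def hits_def by blast
  then have "syndetic {k. k \<ge> 1 \<and> n + k \<in> hits (orbit_map fs 1) ?U V'}"
    by (rule syndetic_shift_down)
  then show "syndetic (hits (\<lambda>k. f ^^ k) U V)"
  proof (rule syndetic_mono, clarify)
    fix k assume k: "k \<ge> 1" "n + k \<in> hits (orbit_map fs 1) ?U V'"
    show "k \<in> hits (\<lambda>k. f ^^ k) U V"
      by (rule hits_limit[OF assms(1) sh k(2,1)]) (use n k in auto)
  qed
qed

lemma limit_weakly_mixing:
  fixes fs :: "nat \<Rightarrow> 'a::metric_space \<Rightarrow> 'a"
  assumes "nds fs" "converges_collectively fs f" "weakly_mixing fs"
  shows "weakly_mixing (\<lambda>_. f)"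
  unfolding weakly_mixing_def
proof (intro allI impI, elim conjE)
  fix U1 U2 V1 V2 :: "'a set"
  assume U1: "open U1" "U1 \<noteq> {}" and U2: "open U2" "U2 \<noteq> {}"
    and V1: "open V1" "V1 \<noteq> {}" and V2: "open V2" "V2 \<noteq> {}"
  obtain W1 r1 where W1: "open W1" "W1 \<noteq> {}"
    and sh1: "\<And>n k x. r1 \<le> n \<Longrightarrow> k \<ge> 1 \<Longrightarrow> orbit_map fs (1 + n) k x \<in> W1 \<Longrightarrow> (f ^^ k) x \<in> V1"
    using shadowing[OF assms(1,2) V1] by metis
  obtain W2 r2 where W2: "open W2" "W2 \<noteq> {}"
    and sh2: "\<And>n k x. r2 \<le> n \<Longrightarrow> k \<ge> 1 \<Longrightarrow> orbit_map fs (1 + n) k x \<in> W2 \<Longrightarrow> (f ^^ k) x \<in> V2"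
    using shadowing[OF assms(1,2) V2] by metis
  \<comment> \<open>Weak mixing gives one \<open>n\<close> that makes both preimages nonempty and
    lies past both thresholds.\<close>
  obtain n where n: "n > max r1 r2" "n \<in> hits (orbit_map fs 1) UNIV U1"
      "n \<in> hits (orbit_map fs 1) UNIV U2"
    using weakly_mixing_unbounded[OF assms(1,3), of UNIV UNIV U1 U2 "max r1 r2"] U1 U2 by auto
  let ?U = "\<lambda>U. orbit_map fs 1 n -` U"
  have U: "open (?U U1)" "?U U1 \<noteq> {}" "open (?U U2)" "?U U2 \<noteq> {}"
    using open_vimage_orbit_map[OF assms(1)] U1 U2 n by (auto simp: hits_iff)
  \<comment> \<open>A common hitting time beyond \<open>n\<close> leaves a positive remainder
    \<open>k = m - n\<close> to be shadowed by \<open>f\<close>.\<close>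
  obtain m where m: "m > n" "m \<in> hits (orbit_map fs 1) (?U U1) W1"
      "m \<in> hits (orbit_map fs 1) (?U U2) W2"
    using weakly_mixing_unbounded[OF assms(1,3) U W1 W2] by blast
  define k where "k = m - n"
  have k: "m = n + k" "k \<ge> 1" using m by (auto simp: k_def)
  have "k \<in> hits (\<lambda>k. f ^^ k) U1 V1"
    by (rule hits_limit[OF assms(1) sh1 m(2)[unfolded k(1)] k(2)]) (use n k in auto)
  moreover have "k \<in> hits (\<lambda>k. f ^^ k) U2 V2"
    by (rule hits_limit[OF assms(1) sh2 m(3)[unfolded k(1)] k(2)]) (use n k in auto)
  ultimately show "\<exists>n\<ge>1. orbit_map (\<lambda>_. f) 1 n ` U1 \<inter> V1 \<noteq> {} \<and> orbit_map (\<lambda>_. f) 1 n ` U2 \<inter> V2 \<noteq> {}"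
    using k(2) unfolding hits_def orbit_map_const by blast
qed

section \<open>Thick syndeticity for iterates of a single map\<close>

lemma open_vimage_funpow:
  fixes f :: "'a::topological_space \<Rightarrow> 'a"
  assumes "continuous_on UNIV f" "open V"
  shows "open ((f ^^ n) -` V)"
proof (induction n)
  case (Suc n)
  have "(f ^^ Suc n) -` V = f -` ((f ^^ n) -` V)" unfolding funpow_Suc_right vimage_comp ..
  moreover have "open (f -` ((f ^^ n) -` V))"
    using assms(1) Suc by (simp add: continuous_on_open_vimage)
  ultimately show ?case by (simp only:)
qed (simp add: assms)

text \<open>Weak mixing gives one \<open>n\<close> for which \<open>U1\<close> meets the
  \<open>n\<close>-th preimage of \<open>U2\<close> and \<open>V1\<close> meets that of
  \<open>V2\<close>; these intersections are the new sets. A hit between them is a hit from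
  \<open>U1\<close> to \<open>V1\<close>, and applying \<open>f ^^ n\<close> turns it into a hit
  from \<open>U2\<close> to \<open>V2\<close> at the same time, since iterates of one map
  commute.\<close>

lemma Furstenberg_intersection:
  fixes f :: "'a::topological_space \<Rightarrow> 'a"
  assumes cont: "continuous_on UNIV f"
    and wm: "weakly_mixing (\<lambda>_. f)"
    and "open U1" "U1 \<noteq> {}" "open U2" "U2 \<noteq> {}" "open V1" "V1 \<noteq> {}" "open V2" "V2 \<noteq> {}"
  obtains U V where "open U" "U \<noteq> {}" "open V" "V \<noteq> {}"
    "hits (\<lambda>k. f ^^ k) U V \<subseteq> hits (\<lambda>k. f ^^ k) U1 V1 \<inter> hits (\<lambda>k. f ^^ k) U2 V2"
proof -
  obtain n where n: "n \<in> hits (\<lambda>k. f ^^ k) U1 U2" "n \<in> hits (\<lambda>k. f ^^ k) V1 V2"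
    using weakly_mixingD[OF wm, of U1 V1 U2 V2] assms(3-) by (auto simp: orbit_map_const)
  show thesis
  proof (rule that[of "U1 \<inter> (f ^^ n) -` U2" "V1 \<inter> (f ^^ n) -` V2"])
    show "hits (\<lambda>k. f ^^ k) (U1 \<inter> (f ^^ n) -` U2) (V1 \<inter> (f ^^ n) -` V2)
      \<subseteq> hits (\<lambda>k. f ^^ k) U1 V1 \<inter> hits (\<lambda>k. f ^^ k) U2 V2" (is "?L \<subseteq> _")
    proof
      fix k assume "k \<in> ?L"
      then obtain x where x: "k \<ge> 1" "x \<in> U1" "(f ^^ n) x \<in> U2" "(f ^^ k) x \<in> V1"
        "(f ^^ n) ((f ^^ k) x) \<in> V2" by (auto simp: hits_iff)
      have "(f ^^ n) ((f ^^ k) x) = (f ^^ k) ((f ^^ n) x)"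
        by (metis add.commute comp_apply funpow_add)
      then show "k \<in> hits (\<lambda>k. f ^^ k) U1 V1 \<inter> hits (\<lambda>k. f ^^ k) U2 V2"
        using x by (auto simp: hits_iff)
    qed
  qed (use n assms open_vimage_funpow[OF cont] in \<open>auto simp: hits_iff\<close>)
qed

text \<open>Hitting \<open>V\<close> at time \<open>n + j\<close> amounts to hitting its
  \<open>j\<close>-th preimage at time \<open>n\<close>. Blocks of hitting times are thus
  intersections of hitting time sets, to which the intersection lemma applies.\<close>

lemma thickly_syndetic_hits_funpow:
  fixes f :: "'a::topological_space \<Rightarrow> 'a"
  assumes cont: "continuous_on UNIV f"
    and wm: "weakly_mixing (\<lambda>_. f)"
    and st: "syndetically_transitive (\<lambda>_. f)"
    and UV: "open U" "U \<noteq> {}" "open V" "V \<noteq> {}"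
  shows "thickly_syndetic (hits (\<lambda>k. f ^^ k) U V)"
proof -
  have synd: "syndetic (hits (\<lambda>k. f ^^ k) A B)" if "open A" "A \<noteq> {}" "open B" "B \<noteq> {}" for A B
    using st that unfolding syndetically_transitive_def hits_def orbit_map_const by blast
  \<comment> \<open>Syndetic hitting times are unbounded, so some \<open>m \<ge> j\<close> has
    \<open>f ^^ m\<close> reaching \<open>W\<close>; the first \<open>m - j\<close> steps lead into
    the preimage.\<close>
  have vim: "(f ^^ j) -` W \<noteq> {}" if "open W" "W \<noteq> {}" for j W
  proof -
    have "syndetic (hits (\<lambda>k. f ^^ k) UNIV W)" using synd[of UNIV W] that by blast
    then obtain M where M: "\<And>i. i \<ge> 1 \<Longrightarrow> \<exists>m\<in>hits (\<lambda>k. f ^^ k) UNIV W. i \<le> m \<and> m \<le> i + M"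
      by (rule syndeticE) blast
    obtain m where m: "m \<in> hits (\<lambda>k. f ^^ k) UNIV W" "j \<le> m" using M[of "Suc j"] by auto
    then obtain x where "(f ^^ m) x \<in> W" by (auto simp: hits_iff)
    moreover have "(f ^^ m) x = (f ^^ j) ((f ^^ (m - j)) x)"
      using m(2) by (metis comp_apply funpow_add le_add_diff_inverse)
    ultimately show ?thesis by (metis vimageI empty_iff)
  qed
  \<comment> \<open>One pair of sets controls the whole block, which lets each step of the induction
    add a single further preimage of \<open>V\<close>.\<close>
  have "\<exists>A B. open A \<and> A \<noteq> {} \<and> open B \<and> B \<noteq> {} \<and>
    (\<forall>n\<in>hits (\<lambda>k. f ^^ k) A B. {n..n + L} \<subseteq> hits (\<lambda>k. f ^^ k) U V)" for L
  proof (induction L)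
    case 0
    show ?case using UV by (intro exI[of _ U] exI[of _ V]) auto
  next
    case (Suc L)
    then obtain A B where AB: "open A" "A \<noteq> {}" "open B" "B \<noteq> {}"
      and sub: "\<forall>n\<in>hits (\<lambda>k. f ^^ k) A B. {n..n + L} \<subseteq> hits (\<lambda>k. f ^^ k) U V" by blast
    let ?W = "(f ^^ Suc L) -` V"
    have W: "open ?W" "?W \<noteq> {}" using open_vimage_funpow[OF cont UV(3)] vim[OF UV(3,4)] by blast+
    obtain A' B' where AB': "open A'" "A' \<noteq> {}" "open B'" "B' \<noteq> {}"
      and sub': "hits (\<lambda>k. f ^^ k) A' B' \<subseteq> hits (\<lambda>k. f ^^ k) A B \<inter> hits (\<lambda>k. f ^^ k) U ?W"
      by (rule Furstenberg_intersection[OF cont wm AB(1,2) UV(1,2) AB(3,4) W])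
    have "{n..n + Suc L} \<subseteq> hits (\<lambda>k. f ^^ k) U V" if n: "n \<in> hits (\<lambda>k. f ^^ k) A' B'" for n
    proof -
      have "n \<in> hits (\<lambda>k. f ^^ k) U ?W" using n sub' by blast
      then obtain x where x: "x \<in> U" "(f ^^ Suc L) ((f ^^ n) x) \<in> V"
        unfolding hits_iff by blast
      have "(f ^^ (n + Suc L)) x = (f ^^ Suc L) ((f ^^ n) x)"
        by (metis add.commute comp_apply funpow_add)
      then have "\<exists>x\<in>U. (f ^^ (n + Suc L)) x \<in> V" using x by metis
      then have "n + Suc L \<in> hits (\<lambda>k. f ^^ k) U V" unfolding hits_iff by simp
      moreover have "{n..n + L} \<subseteq> hits (\<lambda>k. f ^^ k) U V" using n sub sub' by blast
      moreover have "{n..n + Suc L} = insert (n + Suc L) {n..n + L}" by auto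
      ultimately show ?thesis by simp
    qed
    then show ?case using AB' by blast
  qed
  then have "syndetic {n. {n..n + L} \<subseteq> hits (\<lambda>k. f ^^ k) U V}" for L
    by (metis (mono_tags, lifting) syndetic_mono synd mem_Collect_eq subsetI)
  then show ?thesis unfolding thickly_syndetic_def ..
qed

section \<open>Return to the sequence and to the product\<close>

text \<open>After \<open>n\<close> steps, with \<open>n\<close> the shadowing threshold, the image
  of \<open>U\<close> has nonempty interior by feeble openness. Hits of \<open>f\<close> from this
  interior to \<open>V'\<close> become hits of \<open>fs\<close> from \<open>U\<close> to
  \<open>V\<close>, delayed by \<open>n\<close>.\<close>

lemma nds_thickly_syndetic:
  fixes fs :: "nat \<Rightarrow> 'a::metric_space \<Rightarrow> 'a"
  assumes "nds fs" "feeble_open fs" "continuous_on UNIV f" "converges_collectively fs f"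
    "syndetically_transitive fs" "weakly_mixing fs"
    and UV: "open U" "U \<noteq> {}" "open V" "V \<noteq> {}"
  shows "thickly_syndetic (hits (orbit_map fs 1) U V)"
proof -
  obtain V' n where V': "open V'" "V' \<noteq> {}"
    and sh: "\<And>k x. k \<ge> 1 \<Longrightarrow> (f ^^ k) x \<in> V' \<Longrightarrow> orbit_map fs (1 + n) k x \<in> V"
    using shadowing[OF assms(1,4) UV(3,4)] by (metis order_refl)
  let ?W = "interior (orbit_map fs 1 n ` U)"
  have W: "open ?W" "?W \<noteq> {}" using feeble_open_orbit_map[OF assms(2) _ UV(1,2)] by auto
  have "thickly_syndetic (hits (\<lambda>k. f ^^ k) ?W V')"
    using limit_weakly_mixing[OF assms(1,4,6)] limit_syndetically_transitive[OF assms(1,4,5,6)] W V'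
    by (rule thickly_syndetic_hits_funpow[OF assms(3)])
  then have "thickly_syndetic ((+) n ` hits (\<lambda>k. f ^^ k) ?W V')"
    by (rule thickly_syndetic_shift_up)
  then show ?thesis
  proof (rule thickly_syndetic_mono, clarify)
    fix k assume "k \<in> hits (\<lambda>k. f ^^ k) ?W V'"
    then obtain w where k: "k \<ge> 1" "w \<in> ?W" "(f ^^ k) w \<in> V'" by (auto simp: hits_iff)
    obtain x where x: "x \<in> U" "w = orbit_map fs 1 n x" using k(2) interior_subset by blast
    have "orbit_map fs 1 (n + k) x \<in> V" using sh[OF k(1,3)] x(2) by (simp add: orbit_map_add)
    then show "n + k \<in> hits (orbit_map fs 1) U V" using x(1) k(1) by (auto simp: hits_iff)
  qed
qed

lemma open_prod_nonempty_elim: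
  fixes S :: "('a::topological_space \<times> 'b::topological_space) set"
  assumes "open S" "S \<noteq> {}"
  obtains A B where "open A" "A \<noteq> {}" "open B" "B \<noteq> {}" "A \<times> B \<subseteq> S"
  proof -
  obtain x where "x \<in> S" using assms(2) by blast
  then obtain A B where "open A" "open B" "x \<in> A \<times> B" "A \<times> B \<subseteq> S"
    using assms(1) open_prod_elim by metis
  then show thesis by (intro that[of A B]) auto
qed

theorem theorem8:
  fixes fs :: "nat \<Rightarrow> 'a::metric_space \<Rightarrow> 'a"
    and gs :: "nat \<Rightarrow> 'b::metric_space \<Rightarrow> 'b"
    and f :: "'a \<Rightarrow> 'a"
    and g :: "'b \<Rightarrow> 'b"
  assumes "nds fs" and "nds gs"
    and "feeble_open fs" and "feeble_open gs"
    and "continuous_on UNIV f" and "continuous_on UNIV g"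
    and "converges_collectively fs f" and "converges_collectively gs g"
    and "syndetically_transitive fs" and "weakly_mixing fs"
    and "syndetically_transitive gs" and "weakly_mixing gs"
  shows "syndetically_transitive (prod_nds fs gs) \<and> weakly_mixing (prod_nds fs gs)"
proof -
  let ?P = "orbit_map (prod_nds fs gs) 1"
  have thick: "thickly_syndetic (hits ?P U V)" if U: "open U" "U \<noteq> {}" and V: "open V" "V \<noteq> {}" for U V
  proof -
    obtain A B where AB: "open A" "A \<noteq> {}" "open B" "B \<noteq> {}" "A \<times> B \<subseteq> U"
      using U by (rule open_prod_nonempty_elim)
    obtain C D where CD: "open C" "C \<noteq> {}" "open D" "D \<noteq> {}" "C \<times> D \<subseteq> V"
      using V by (rule open_prod_nonempty_elim)
    \<comment> \<open>Two syndetic sets may be disjoint; thick syndeticity of both factors is what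
      makes their common times recur.\<close>
    have "thickly_syndetic (hits (orbit_map fs 1) A C \<inter> hits (orbit_map gs 1) B D)"
      using assms AB CD
      by (intro thickly_syndetic_Int nds_thickly_syndetic[of fs f] nds_thickly_syndetic[of gs g])
    then show ?thesis
    proof (rule thickly_syndetic_mono, clarify)
      fix n assume n: "n \<in> hits (orbit_map fs 1) A C" "n \<in> hits (orbit_map gs 1) B D"
      then obtain a b where "a \<in> A" "b \<in> B" "orbit_map fs 1 n a \<in> C" "orbit_map gs 1 n b \<in> D"
        by (auto simp: hits_iff)
      then have "(a, b) \<in> U" "?P n (a, b) \<in> V" using AB(5) CD(5) by (auto simp: orbit_map_prod_nds)
      then show "n \<in> hits ?P U V" using n(1) unfolding hits_iff by blast
    qed
  qed
  have "syndetically_transitive (prod_nds fs gs)"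
    unfolding syndetically_transitive_def hits_def[symmetric]
    using thick thickly_syndetic_imp_syndetic by blast
  moreover have "weakly_mixing (prod_nds fs gs)"
    unfolding weakly_mixing_def
  proof (intro allI impI, elim conjE)
    fix U1 U2 V1 V2 :: "('a \<times> 'b) set"
    assume "open U1" "U1 \<noteq> {}" "open U2" "U2 \<noteq> {}" "open V1" "V1 \<noteq> {}" "open V2" "V2 \<noteq> {}"
    \<comment> \<open>The same closure under intersection, now for two pairs in the product, gives
      weak mixing, as a syndetic set is nonempty.\<close>
    then have "syndetic (hits ?P U1 V1 \<inter> hits ?P U2 V2)"
      by (intro thickly_syndetic_imp_syndetic thickly_syndetic_Int thick)
    then obtain n where "n \<in> hits ?P U1 V1 \<inter> hits ?P U2 V2"
      unfolding syndetic_def by blast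
    then show "\<exists>n\<ge>1. ?P n ` U1 \<inter> V1 \<noteq> {} \<and> ?P n ` U2 \<inter> V2 \<noteq> {}"
      unfolding hits_def by blast
  qed
  ultimately show ?thesis ..
qed

end
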